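(* Let $R$ be (the vertex set of) a regular polygon and $P\subseteq R$ with $|P|\geq 3$. Then for every nonempty finite set $A\subseteq\mathbb{C}$ (with $|A|\ge2$), \[ S_P(n)\geq\Omega\left(n^{i_R(A)}\right). \]
   Context: Sets $A,B\subseteq\mathbb{C}$ are similar if $B=zA+w$ for some $z,w\in\mathbb{C}$, $z\neq0$. $S_P(Q)$ is the number of subsets of $Q$ similar to $P$, and $S_P(n)$ is the maximum of $S_P(Q)$ over all $n$-point sets $Q\subseteq\mathbb{C}$. $\mathrm{Iso}^+(R)$ is the group of orientation-preserving isometries of the plane mapping $R$ onto itself, and $i_R(A)=\log\left(|\mathrm{Iso}^+(R)|\,S_R(A)+|A|\right)/\log|A|$. *)

theory Defs
  imports Complex_Main "HOL-Library.Landau_Symbols"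
begin

definition similar :: "complex set \<Rightarrow> complex set \<Rightarrow> bool" where
  "similar A B \<longleftrightarrow> (\<exists>z w. z \<noteq> 0 \<and> B = (\<lambda>x. z * x + w) ` A)"

definition sim_count :: "complex set \<Rightarrow> complex set \<Rightarrow> nat" where
  "sim_count P Q = card {T. T \<subseteq> Q \<and> similar P T}"

definition sim_max :: "complex set \<Rightarrow> nat \<Rightarrow> nat" where
  "sim_max P n = Max {sim_count P Q | Q. finite Q \<and> card Q = n}"

lemma sim_count_le: "finite Q \<Longrightarrow> sim_count P Q \<le> 2 ^ card Q"
  unfolding sim_count_def
  by (subst card_Pow[symmetric]) (auto intro!: card_mono)

lemma finite_sim_counts: "finite {sim_count P Q | Q. finite Q \<and> card Q = n}"
  by (rule finite_subset[of _ "{..2 ^ n}"]) (auto intro: order.trans[OF sim_count_le])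

lemma sim_counts_nonempty: "{sim_count P Q | Q. finite Q \<and> card Q = n} \<noteq> {}"
  using infinite_arbitrarily_large[OF infinite_UNIV_char_0[where 'a = complex]] by blast

text \<open>
  The sign of this quantity, twice the signed area of the triangle \<open>x y z\<close>, is the
  orientation of the triple: positive iff \<open>x, y, z\<close> are in counterclockwise order.
\<close>
definition signed_area2 :: "complex \<Rightarrow> complex \<Rightarrow> complex \<Rightarrow> real" where
  "signed_area2 x y z = Im (cnj (y - x) * (z - x))"

definition orientation_preserving_isometry :: "(complex \<Rightarrow> complex) \<Rightarrow> bool" where
  "orientation_preserving_isometry f \<longleftrightarrow>
     (\<forall>x y. dist (f x) (f y) = dist x y) \<and>
     (\<forall>x y z. sgn (signed_area2 (f x) (f y) (f z)) = sgn (signed_area2 x y z))"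

definition Iso_plus :: "complex set \<Rightarrow> (complex \<Rightarrow> complex) set" where
  "Iso_plus R = {f. orientation_preserving_isometry f \<and> f ` R = R}"

lemma orientation_preserving_isometry_iff:
  "orientation_preserving_isometry f \<longleftrightarrow> (\<exists>u w. norm u = 1 \<and> f = (\<lambda>x. u * x + w))"
proof
  assume f: "orientation_preserving_isometry f"
  define g where "g x = f x - f 0" for x
  have d: "norm (g x - g y) = norm (x - y)" for x y
    using f by (auto simp: orientation_preserving_isometry_def g_def dist_norm)
  have n: "norm (g x) = norm x" for x
    using d[of x 0] by (simp add: g_def)
  have re: "Re (cnj (g 1) * g x) = Re x" for x
  proof -
    have "(norm (a - b))\<^sup>2 = (norm a)\<^sup>2 + (norm b)\<^sup>2 - 2 * Re (cnj a * b)" for a b :: complex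
      unfolding cmod_power2 by (simp add: power2_eq_square algebra_simps)
    from this[of "g 1" "g x"] this[of 1 x] show ?thesis by (simp add: d n)
  qed
  have im: "Im (cnj (g 1) * g x) = Im x" for x
  proof -
    let ?p = "cnj (g 1) * g x"
    have "norm ?p = norm x" by (simp add: norm_mult n)
    then have "(Re ?p)\<^sup>2 + (Im ?p)\<^sup>2 = (Re x)\<^sup>2 + (Im x)\<^sup>2"
      using cmod_power2 by metis
    then have "\<bar>Im ?p\<bar> = \<bar>Im x\<bar>" using re[of x] by (simp add: abs_eq_iff power2_eq_iff)
    moreover have "sgn (Im ?p) = sgn (Im x)"
      using f[unfolded orientation_preserving_isometry_def, THEN conjunct2, rule_format, of 0 1 x]
      by (simp add: signed_area2_def g_def)
    ultimately show ?thesis by (metis mult_sgn_abs)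
  qed
  have "cnj (g 1) * g x = x" for x using re im by (simp add: complex_eq_iff)
  moreover have "g 1 * cnj (g 1) = 1" using n[of 1] by (simp add: complex_norm_square[symmetric])
  ultimately have "g x = g 1 * x" for x by (metis mult.assoc mult_1)
  then have "f = (\<lambda>x. g 1 * x + f 0)" by (auto simp: g_def fun_eq_iff algebra_simps)
  then show "\<exists>u w. norm u = 1 \<and> f = (\<lambda>x. u * x + w)" using n[of 1] by auto
next
  assume "\<exists>u w. norm u = 1 \<and> f = (\<lambda>x. u * x + w)"
  then obtain u w where u: "norm u = 1" and f: "f = (\<lambda>x. u * x + w)" by auto
  have 1: "cnj u * u = 1" using u by (metis complex_norm_square mult.commute of_real_1 power_one)
  have inv: "cnj (u * a) * (u * b) = cnj a * b" for a b
    using 1 by (metis complex_cnj_mult mult.assoc mult.commute mult_1)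
  have diff: "f x - f y = u * (x - y)" for x y by (simp add: f algebra_simps)
  show "orientation_preserving_isometry f"
    unfolding orientation_preserving_isometry_def signed_area2_def dist_norm diff inv
    by (simp add: norm_mult u)
qed

text \<open>The vertex set of a regular \<open>k\<close>-gon with centre \<open>c\<close> and circumradius \<open>r\<close>.\<close>
definition regular_polygon :: "complex set \<Rightarrow> bool" where
  "regular_polygon R \<longleftrightarrow>
     (\<exists>(k::nat) (c::complex) (r::real) (\<theta>::real). k \<ge> 3 \<and> r > 0 \<and>
        R = (\<lambda>j. c + of_real r * cis (\<theta> + 2 * pi * real j / real k)) ` {..<k})"

definition iso_index :: "complex set \<Rightarrow> complex set \<Rightarrow> real" where
  "iso_index R A =
     ln (real (card (Iso_plus R)) * real (sim_count R A) + real (card A)) / ln (real (card A))"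

end

theory Submission
  imports Defs
begin

text \<open>
  Count affine maps \<open>x \<mapsto> z x + w\<close>, constants included, that carry \<open>R\<close> into \<open>A\<close>; the number
  of these is at least the argument of the logarithm in the index. If \<open>v\<close> is generic, then
  \<open>(f, g) \<mapsto> f + v g\<close> embeds pairs of such maps into the maps carrying \<open>R\<close> into \<open>A + v A\<close>, a set
  of size \<open>|A|\<^sup>2\<close>, so both the number of maps and the number of points can be raised to the
  \<open>m\<close>-th power. A copy of \<open>P\<close> arises from at most \<open>|P|\<^sup>2\<close> nonconstant maps, and the constants
  are negligible as soon as the index exceeds 1. When it does not, \<open>A = R\<close> already gives a
  superlinear bound.
\<close>

section \<open>Affine maps into a finite set\<close>

definition affine_maps :: "complex set \<Rightarrow> complex set \<Rightarrow> (complex \<Rightarrow> complex) set" where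
  "affine_maps R A = {f. (\<exists>z w. f = (\<lambda>x. z * x + w)) \<and> f ` R \<subseteq> A}"

lemma affine_mapsI: "f = (\<lambda>x. z * x + w) \<Longrightarrow> f ` R \<subseteq> A \<Longrightarrow> f \<in> affine_maps R A"
  by (auto simp: affine_maps_def)

lemma affine_eqI:
  fixes f g :: "complex \<Rightarrow> complex"
  assumes "\<exists>z w. f = (\<lambda>x. z * x + w)" "\<exists>z w. g = (\<lambda>x. z * x + w)"
    and "a \<noteq> b" "f a = g a" "f b = g b"
  shows "f = g"
proof -
  obtain z w z' w' where f: "f = (\<lambda>x. z * x + w)" and g: "g = (\<lambda>x. z' * x + w')"
    using assms(1,2) by blast
  have "z * a + w = z' * a + w'" "z * b + w = z' * b + w'"
    using assms(4,5) by (simp_all add: f g)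
  then have "(z - z') * (a - b) = 0" by algebra
  with \<open>a \<noteq> b\<close> have "z = z'" by simp
  with \<open>z * a + w = z' * a + w'\<close> show ?thesis by (simp add: f g)
qed

text \<open>Two values pin down an affine map; both the finiteness and the quadratic bound that
  follow come from this.\<close>

lemma inj_on_affine_maps:
  assumes "a \<noteq> b"
  shows "inj_on (\<lambda>f. (f a, f b)) (affine_maps R A)"
  using affine_eqI[OF _ _ assms] by (auto simp: affine_maps_def intro!: inj_onI)

lemma
  assumes "finite A" "a \<in> R" "b \<in> R" "a \<noteq> b"
  shows finite_affine_maps: "finite (affine_maps R A)"
    and card_affine_maps_le: "card (affine_maps R A) \<le> (card A)\<^sup>2"
proof -
  have sub: "(\<lambda>f. (f a, f b)) ` affine_maps R A \<subseteq> A \<times> A"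
    using assms by (auto simp: affine_maps_def)
  show "finite (affine_maps R A)"
    by (rule inj_on_finite[OF inj_on_affine_maps[OF \<open>a \<noteq> b\<close>] sub]) (simp add: assms)
  show "card (affine_maps R A) \<le> (card A)\<^sup>2"
    using card_inj_on_le[OF inj_on_affine_maps[OF \<open>a \<noteq> b\<close>] sub] assms(1)
    by (simp add: card_cartesian_product power2_eq_square)
qed

lemma const_in_affine_maps: "y \<in> A \<Longrightarrow> (\<lambda>x. y) \<in> affine_maps R A"
  by (rule affine_mapsI[of _ 0 y]) auto

section \<open>Affine maps counted against points and similar copies\<close>

text \<open>The constants already number \<open>card R\<close>, and the identity is one map more.
  This serves the case in which \<open>A\<close> itself gives no exponent above 1.\<close>

lemma card_less_affine_maps_self:
  assumes "finite R" "a \<in> R" "b \<in> R" "a \<noteq> b"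
  shows "card R < card (affine_maps R R)"
proof -
  let ?C = "(\<lambda>y x::complex. y) ` R"
  have "card ?C = card R"
    by (intro card_image inj_onI) (metis)
  moreover have "(\<lambda>x. x) \<in> affine_maps R R"
    by (rule affine_mapsI[of _ 1 0]) auto
  moreover have "(\<lambda>x. x) \<notin> ?C"
    using \<open>a \<noteq> b\<close> by (auto simp: fun_eq_iff) metis
  moreover have "?C \<subseteq> affine_maps R R"
    by (auto intro: const_in_affine_maps)
  ultimately show ?thesis
    using psubset_card_mono[OF finite_affine_maps[OF assms]] by (metis psubsetI)
qed

text \<open>Each copy \<open>T\<close> of \<open>R\<close> is reached by one fixed similarity \<open>h T\<close> precomposed with any element of
  \<^term>\<open>Iso_plus R\<close>; the constant maps contribute \<open>|A|\<close> more.\<close>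
lemma iso_sim_count_le_affine_maps:
  assumes "finite A" "a \<in> R" "b \<in> R" "a \<noteq> b"
  shows "card (Iso_plus R) * sim_count R A + card A \<le> card (affine_maps R A)"
proof -
  let ?S = "{T. T \<subseteq> A \<and> similar R T}"
  let ?C = "(\<lambda>y x::complex. y) ` A"
  have "\<forall>T\<in>?S. \<exists>h. (\<exists>z w. z \<noteq> 0 \<and> h = (\<lambda>x. z * x + w)) \<and> h ` R = T"
    by (fastforce simp: similar_def)
  then obtain h where
    h: "\<And>T. T \<in> ?S \<Longrightarrow> \<exists>z w. z \<noteq> 0 \<and> h T = (\<lambda>x. z * x + w)"
    and him: "\<And>T. T \<in> ?S \<Longrightarrow> h T ` R = T"
    by metis
  define F where "F = (\<lambda>(g :: complex \<Rightarrow> complex, T). h T \<circ> g)"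
  let ?I = "Iso_plus R \<times> ?S"
  have Fim: "F (g, T) ` R = T" if "g \<in> Iso_plus R" "T \<in> ?S" for g T
  proof -
    have "g ` R = R" using that(1) by (simp add: Iso_plus_def)
    then show ?thesis using him[OF that(2)] unfolding F_def by (metis case_prod_conv image_comp)
  qed
  have hinj: "inj (h T)" if "T \<in> ?S" for T
    using h[OF that] by (auto simp: inj_def)
  \<comment> \<open>The image of \<open>R\<close> under \<open>F (g, T)\<close> recovers
    \<open>T\<close>; cancelling the injective \<open>h T\<close> then recovers
    \<open>g\<close>.\<close>
  have inj: "inj_on F ?I"
  proof (rule inj_onI, clarify)
    fix g T g' T'
    assume A: "g \<in> Iso_plus R" "g' \<in> Iso_plus R" "T \<subseteq> A" "similar R T" "T' \<subseteq> A" "similar R T'"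
      and eq: "F (g, T) = F (g', T')"
    then have "T = T'" using Fim[of g T] Fim[of g' T'] by simp
    moreover have "g = g'"
      using eq hinj[of T] A unfolding \<open>T = T'\<close>[symmetric] F_def
      by (auto simp: fun_eq_iff inj_eq)
    ultimately show "g = g' \<and> T = T'" by simp
  qed
  have sub: "F ` ?I \<subseteq> affine_maps R A"
  proof (clarify)
    fix g T assume A: "g \<in> Iso_plus R" "T \<subseteq> A" "similar R T"
    then obtain z w z' w' where "g = (\<lambda>x. z * x + w)" "h T = (\<lambda>x. z' * x + w')"
      using h[of T] by (auto simp: Iso_plus_def orientation_preserving_isometry_iff)
    then have "F (g, T) = (\<lambda>x. (z' * z) * x + (z' * w + w'))"
      by (auto simp: F_def fun_eq_iff algebra_simps)
    then show "F (g, T) \<in> affine_maps R A"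
      using Fim[of g T] A unfolding affine_maps_def by blast
  qed
  \<comment> \<open>Every map in the image of \<open>F\<close> is injective, while a constant
    identifies \<open>a\<close> with \<open>b\<close>.\<close>
  have disj: "F ` ?I \<inter> ?C = {}"
  proof (rule ccontr)
    assume "F ` ?I \<inter> ?C \<noteq> {}"
    then obtain g T y where A: "g \<in> Iso_plus R" "T \<in> ?S" "F (g, T) = (\<lambda>x. y)" by auto
    have "inj g"
      using A(1) by (auto simp: Iso_plus_def orientation_preserving_isometry_iff inj_def)
    then have "inj (F (g, T))" using hinj[OF A(2)] by (auto simp: F_def intro: inj_compose)
    then show False using A(3) \<open>a \<noteq> b\<close> by (auto simp: inj_def)
  qed
  have fin: "finite (affine_maps R A)" by (rule finite_affine_maps[OF assms])
  have "card (Iso_plus R) * sim_count R A + card A = card (F ` ?I) + card ?C"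
    using card_image[OF inj] card_image[of "\<lambda>y x::complex. y" A]
    by (simp add: card_cartesian_product sim_count_def inj_on_def fun_eq_iff)
  also have "\<dots> = card (F ` ?I \<union> ?C)"
    using finite_subset[OF sub fin] assms(1) disj by (intro card_Un_disjoint[symmetric]) auto
  also have "\<dots> \<le> card (affine_maps R A)"
    using sub by (intro card_mono fin) (auto intro: const_in_affine_maps)
  finally show ?thesis .
qed

text \<open>Sort the nonconstant maps by their image \<open>T\<close> of \<open>P\<close>: each
  \<open>T\<close> is a copy of \<open>P\<close> and receives at most
  \<open>(card P)\<^sup>2\<close> maps. The constants account for the term
  \<open>card Q\<close>.\<close>

lemma card_affine_maps_le_sim_count:
  assumes "finite Q" "finite P" "a \<in> P" "b \<in> P" "a \<noteq> b"
  shows "card (affine_maps P Q) \<le> card Q + (card P)\<^sup>2 * sim_count P Q"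
proof -
  let ?S = "{T. T \<subseteq> Q \<and> similar P T}"
  let ?C = "(\<lambda>y x::complex. y) ` Q"
  let ?U = "\<Union>T\<in>?S. affine_maps P T"
  have finS: "finite ?S" using assms(1) by simp
  have finU: "finite ?U"
    using assms by (intro finite_UN_I finS finite_affine_maps) (auto intro: finite_subset)
  have "affine_maps P Q \<subseteq> ?C \<union> ?U"
  proof
    fix f assume f: "f \<in> affine_maps P Q"
    then obtain z w where zw: "f = (\<lambda>x. z * x + w)" by (auto simp: affine_maps_def)
    show "f \<in> ?C \<union> ?U"
    proof (cases "z = 0")
      case True
      then show ?thesis using f \<open>a \<in> P\<close> zw by (auto simp: affine_maps_def)
    next
      case False
      then have "f ` P \<in> ?S" using f zw by (auto simp: affine_maps_def similar_def)
      moreover have "f \<in> affine_maps P (f ` P)" using f by (auto simp: affine_maps_def)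
      ultimately show ?thesis by blast
    qed
  qed
  then have "card (affine_maps P Q) \<le> card (?C \<union> ?U)"
    using finU assms(1) by (intro card_mono) auto
  also have "\<dots> \<le> card ?C + card ?U" by (rule card_Un_le)
  also have "card ?C \<le> card Q" by (rule card_image_le[OF assms(1)])
  also have "card ?U \<le> (\<Sum>T\<in>?S. card (affine_maps P T))" by (rule card_UN_le[OF finS])
  also have "\<dots> \<le> (\<Sum>T\<in>?S. (card P)\<^sup>2)"
  proof (rule sum_mono)
    fix T assume T: "T \<in> ?S"
    then have "finite T" using assms(1) finite_subset by auto
    from card_affine_maps_le[OF this assms(3-5)]
    have "card (affine_maps P T) \<le> (card T)\<^sup>2" .
    also have "card T \<le> card P"
      using T by (auto simp: similar_def intro: card_image_le[OF assms(2)])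
    finally show "card (affine_maps P T) \<le> (card P)\<^sup>2" by (simp add: power_mono)
  qed
  also have "\<dots> = (card P)\<^sup>2 * sim_count P Q" by (simp add: sim_count_def)
  finally show ?thesis by simp
qed

section \<open>Products of map counts via generic sumsets\<close>

lemma generic_multiplier_exists:
  fixes A B :: "complex set"
  assumes "finite A" "finite B"
  obtains v where "inj_on (\<lambda>(x, y). x + v * y) (A \<times> B)"
proof -
  \<comment> \<open>These finitely many quotients contain every \<open>v\<close> that makes two
    distinct pairs collide; entries with \<open>y = y'\<close> can only add the value 0.\<close>
  let ?E = "(\<lambda>(x, x', y, y'). (x' - x) / (y - y')) ` (A \<times> A \<times> B \<times> B)"
  have "finite ?E" using assms by simp
  then obtain v where v: "v \<notin> ?E"
    using ex_new_if_finite[OF infinite_UNIV_char_0] by blast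
  have "inj_on (\<lambda>(x, y). x + v * y) (A \<times> B)"
  proof (rule inj_onI, clarify)
    fix x y x' y'
    assume in_: "x \<in> A" "y \<in> B" "x' \<in> A" "y' \<in> B" and eq: "x + v * y = x' + v * y'"
    have "y = y'"
    proof (rule ccontr)
      assume "y \<noteq> y'"
      moreover have "v * (y - y') = x' - x" using eq by algebra
      ultimately have "v = (x' - x) / (y - y')" by (simp add: field_simps)
      then show False using v in_ by (auto simp: image_iff)
    qed
    with eq show "x = x' \<and> y = y'" by simp
  qed
  then show thesis by (rule that)
qed

text \<open>On \<open>R\<close> the values of \<open>f\<close> lie in \<open>A\<close> and those of
  \<open>g\<close> in \<open>B\<close>, so a generic \<open>v\<close> lets both be read off from
  \<open>f + v g\<close>. Agreement at \<open>a\<close> and \<open>b\<close> then fixes the two maps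
  everywhere.\<close>

lemma affine_maps_sumset:
  assumes "finite A" "finite B" "a \<in> R" "b \<in> R" "a \<noteq> b"
  obtains Q where "finite Q" "card Q = card A * card B"
    "card (affine_maps R A) * card (affine_maps R B) \<le> card (affine_maps R Q)"
proof -
  obtain v where v: "inj_on (\<lambda>(x, y). x + v * y) (A \<times> B)"
    using generic_multiplier_exists[OF assms(1,2)] .
  define Q where "Q = (\<lambda>(x, y). x + v * y) ` (A \<times> B)"
  define F where "F = (\<lambda>(f, g) x :: complex. f x + v * g x :: complex)"
  have finQ: "finite Q" using assms by (simp add: Q_def)
  have inj: "inj_on F (affine_maps R A \<times> affine_maps R B)"
  proof (rule inj_onI, clarify)
    fix f g f' g'
    assume in_: "f \<in> affine_maps R A" "g \<in> affine_maps R B"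
        "f' \<in> affine_maps R A" "g' \<in> affine_maps R B"
      and eq: "F (f, g) = F (f', g')"
    have "f x = f' x \<and> g x = g' x" if "x \<in> R" for x
    proof -
      have "f x + v * g x = f' x + v * g' x" using fun_cong[OF eq, of x] by (simp add: F_def)
      moreover have "f x \<in> A" "g x \<in> B" "f' x \<in> A" "g' x \<in> B"
        using in_ that by (auto simp: affine_maps_def)
      ultimately show ?thesis using inj_onD[OF v, of "(f x, g x)" "(f' x, g' x)"] by simp
    qed
    then show "f = f' \<and> g = g'"
      using in_ affine_eqI[OF _ _ assms(5)] assms(3,4) by (simp add: affine_maps_def)
  qed
  have sub: "F ` (affine_maps R A \<times> affine_maps R B) \<subseteq> affine_maps R Q"
  proof clarify
    fix f g assume in_: "f \<in> affine_maps R A" "g \<in> affine_maps R B"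
    then obtain z w z' w' where "f = (\<lambda>x. z * x + w)" "g = (\<lambda>x. z' * x + w')"
      by (auto simp: affine_maps_def)
    then have "F (f, g) = (\<lambda>x. (z + v * z') * x + (w + v * w'))"
      by (auto simp: F_def algebra_simps)
    moreover have "F (f, g) ` R \<subseteq> Q"
      using in_ by (fastforce simp: F_def Q_def affine_maps_def image_subset_iff)
    ultimately show "F (f, g) \<in> affine_maps R Q" unfolding affine_maps_def by blast
  qed
  show thesis
  proof
    show "finite Q" by (rule finQ)
    show "card Q = card A * card B"
      using card_image[OF v] by (simp add: Q_def card_cartesian_product)
    show "card (affine_maps R A) * card (affine_maps R B) \<le> card (affine_maps R Q)"
      using card_inj_on_le[OF inj sub finite_affine_maps[OF finQ assms(3-5)]]
      by (simp add: card_cartesian_product)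
  qed
qed

lemma affine_maps_power:
  assumes "finite A" "a \<in> R" "b \<in> R" "a \<noteq> b"
  shows "\<exists>Q. finite Q \<and> card Q = card A ^ m \<and> card (affine_maps R A) ^ m \<le> card (affine_maps R Q)"
proof (induction m)
  case 0
  have "(\<lambda>x. 0) \<in> affine_maps R {0}" by (simp add: const_in_affine_maps)
  then have "card (affine_maps R {0}) > 0"
    using finite_affine_maps[of "{0}", OF _ assms(2-4)] by (auto simp: card_gt_0_iff)
  then show ?case by (intro exI[of _ "{0}"]) auto
next
  case (Suc m)
  then obtain Q where Q: "finite Q" "card Q = card A ^ m"
    "card (affine_maps R A) ^ m \<le> card (affine_maps R Q)" by blast
  obtain Q' where Q': "finite Q'" "card Q' = card A * card Q"
    "card (affine_maps R A) * card (affine_maps R Q) \<le> card (affine_maps R Q')"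
    using affine_maps_sumset[OF assms(1) Q(1) assms(2-4)] .
  have "card (affine_maps R A) ^ Suc m \<le> card (affine_maps R A) * card (affine_maps R Q)"
    using Q(3) by simp
  also note Q'(3)
  finally show ?case using Q(2) Q'(1,2) by auto
qed

section \<open>From powers of the cardinality to all sizes\<close>

text \<open>Padding \<open>Q\<close> with further points up to size \<open>n\<close> loses no copy
  of \<open>P\<close>.\<close>

lemma sim_count_le_sim_max:
  assumes "finite Q" "card Q \<le> n"
  shows "sim_count P Q \<le> sim_max P n"
proof -
  obtain Q' where Q': "finite Q'" "Q \<subseteq> Q'" "card Q' = n"
    using infinite_arbitrarily_large[of "UNIV - Q" "n - card Q"]
      assms Diff_infinite_finite[OF assms(1) infinite_UNIV_char_0]
    by (metis (no_types, lifting) Diff_disjoint Int_Diff Int_absorb2 card_Un_disjoint finite_UnI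
        le_add_diff_inverse sup_ge1 Diff_eq_empty_iff Int_commute inf_top_left inf.absorb_iff2)
  have "sim_count P Q \<le> sim_count P Q'"
    unfolding sim_count_def using Q' by (intro card_mono) auto
  also have "\<dots> \<le> sim_max P n"
    unfolding sim_max_def using Q' by (intro Max_ge finite_sim_counts) blast
  finally show ?thesis .
qed

text \<open>Round \<open>n\<close> down to a power \<open>card A ^ m\<close> and use the iterated
  sumset of that size. By \<open>gt\<close>, the maps outnumber the constants by a fixed factor, so
  a fixed share of them yields genuine copies.\<close>

lemma sim_max_bigomega:
  assumes "finite A" "card A \<ge> 2" "finite P" "P \<subseteq> R" "a \<in> P" "b \<in> P" "a \<noteq> b"
    and gt: "card A < card (affine_maps R A)"
  shows "(\<lambda>n. real (sim_max P n)) \<in>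
    \<Omega>(\<lambda>n. real n powr (ln (real (card (affine_maps R A))) / ln (real (card A))))"
proof -
  define k where "k = real (card A)"
  define N where "N = real (card (affine_maps R A))"
  define p where "p = (real (card P))\<^sup>2"
  define i where "i = ln N / ln k"
  \<comment> \<open>The factor \<open>1 - k / N\<close> pays for the constants, \<open>1 / p\<close>
    for the maps sharing one copy, and \<open>1 / N\<close> for rounding \<open>n\<close> down to a
    power of \<open>k\<close>.\<close>
  define c where "c = (1 - k / N) / (p * N)"
  have kN: "2 \<le> k" "k < N" using assms(2) gt by (simp_all add: k_def N_def)
  have p: "p > 0" using assms(3,5) by (auto simp: p_def card_gt_0_iff)
  have c: "c > 0" using kN p by (simp add: c_def)
  have i: "i > 0" using kN by (simp add: i_def)
  have ki: "k powr i = N" using kN by (simp add: powr_def i_def)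
  have ab: "a \<in> R" "b \<in> R" using assms(4-6) by auto
  have main: "c * real n powr i \<le> real (sim_max P n)" if n: "n \<ge> card A" for n
  proof -
    obtain m where m: "card A ^ m \<le> n" "n < card A ^ (m + 1)"
      using ex_power_ivl1[of "card A" n] assms(2) n by auto
    \<comment> \<open>With \<open>m\<close> at least 1, the ratio \<open>(k / N) ^ m\<close> is at
      most \<open>k / N\<close>, a bound independent of \<open>n\<close>.\<close>
    have "m \<noteq> 0" using m(2) n by (cases m) auto
    obtain Q where Q: "finite Q" "card Q = card A ^ m"
      "card (affine_maps R A) ^ m \<le> card (affine_maps R Q)"
      using affine_maps_power[OF assms(1) ab assms(7)] by blast
    \<comment> \<open>A map is constrained on fewer points when \<open>R\<close> is replaced by its
      subset \<open>P\<close>.\<close>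
    have "card (affine_maps R Q) \<le> card (affine_maps P Q)"
      using assms(4)
      by (intro card_mono finite_affine_maps[OF Q(1) assms(5-7)]) (auto simp: affine_maps_def)
    also have "\<dots> \<le> card Q + (card P)\<^sup>2 * sim_count P Q"
      by (rule card_affine_maps_le_sim_count[OF Q(1) assms(3,5-7)])
    also have "\<dots> \<le> card A ^ m + (card P)\<^sup>2 * sim_max P n"
      using sim_count_le_sim_max[OF Q(1), of n P] Q(2) m(1) by simp
    finally have "card (affine_maps R A) ^ m \<le> card A ^ m + (card P)\<^sup>2 * sim_max P n"
      using Q(3) by simp
    then have "real (card (affine_maps R A) ^ m) \<le> real (card A ^ m + (card P)\<^sup>2 * sim_max P n)"
      by (simp only: of_nat_le_iff)
    then have 1: "N ^ m \<le> k ^ m + p * sim_max P n"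
      by (simp add: N_def k_def p_def)
    have "k ^ m = (k / N) ^ m * N ^ m" using kN by (simp add: power_divide)
    also have "(k / N) ^ m \<le> (k / N) ^ 1"
      using kN \<open>m \<noteq> 0\<close> by (intro power_decreasing) auto
    finally have 2: "k ^ m \<le> k / N * N ^ m" using kN by simp
    have "real n \<le> k ^ (m + 1)"
      using m(2) unfolding k_def of_nat_power[symmetric] of_nat_le_iff by simp
    then have "real n powr i \<le> (k ^ (m + 1)) powr i" using i by (intro powr_mono2) auto
    also have "\<dots> = (k powr i) ^ (m + 1)"
      using kN by (simp add: powr_realpow[symmetric] powr_powr mult.commute del: power_Suc)
    finally have 3: "real n powr i \<le> N ^ (m + 1)" by (simp only: ki)
    have "c * real n powr i \<le> c * N ^ (m + 1)" using 3 c by simp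
    also have "\<dots> = (N ^ m - k / N * N ^ m) / p"
      using kN p by (simp add: c_def field_simps)
    also have "\<dots> \<le> (p * sim_max P n) / p"
      using 1 2 p by (intro divide_right_mono) auto
    also have "\<dots> = sim_max P n" using p by simp
    finally show ?thesis .
  qed
  have "(\<lambda>n. real (sim_max P n)) \<in> \<Omega>(\<lambda>n. real n powr i)"
    using main by (intro landau_omega.bigI[OF c] eventually_sequentiallyI[of "card A"]) simp
  then show ?thesis by (simp add: i_def N_def k_def)
qed

lemma powr_bigomega_mono:
  assumes "(i::real) \<le> j"
  shows "(\<lambda>n::nat. real n powr j) \<in> \<Omega>(\<lambda>n. real n powr i)"
  by (rule landau_omega.bigI[of 1])
    (auto intro!: eventually_sequentiallyI[of 1] powr_mono assms)

theorem theorem5: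
  fixes R P A :: "complex set"
  assumes "regular_polygon R"
    and "P \<subseteq> R" and "card P \<ge> 3"
    and "finite A" and "A \<noteq> {}" and "card A \<ge> 2"
  shows "(\<lambda>n::nat. real (sim_max P n)) \<in> \<Omega>(\<lambda>n. real n powr iso_index R A)"
proof -
  have finR: "finite R" using assms(1) by (auto simp: regular_polygon_def)
  have finP: "finite P" using assms(2) finR finite_subset by blast
  obtain a b where ab: "a \<in> P" "b \<in> P" "a \<noteq> b"
    using assms(3) card_le_Suc0_iff_eq[OF finP] by force
  have abR: "a \<in> R" "b \<in> R" using ab assms(2) by auto
  \<comment> \<open>The strict inequality makes the constants negligible. If the product of
    isometries and copies is nonzero, \<open>B = A\<close> satisfies it; otherwise only
    \<open>card A\<close> is left inside the logarithm, the index is 1, and \<open>B = R\<close>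
    suffices.\<close>
  have "\<exists>B. finite B \<and> card B \<ge> 2 \<and> card B < card (affine_maps R B) \<and>
      iso_index R A \<le> ln (real (card (affine_maps R B))) / ln (real (card B))"
  proof (cases "card (Iso_plus R) * sim_count R A = 0")
    case False
    let ?n = "card (Iso_plus R) * sim_count R A + card A"
    have n: "?n \<le> card (affine_maps R A)"
      by (rule iso_sim_count_le_affine_maps[OF assms(4) abR ab(3)])
    have "iso_index R A = ln (real ?n) / ln (real (card A))" by (simp add: iso_index_def)
    also have "\<dots> \<le> ln (real (card (affine_maps R A))) / ln (real (card A))"
      using n assms(6) by (intro divide_right_mono ln_mono) (auto simp del: of_nat_add of_nat_mult)
    finally show ?thesis using n False assms(4,6) by (intro exI[of _ A]) linarith
  next
    case True
    then have "real (card (Iso_plus R)) * real (sim_count R A) = 0" by auto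
    then have "iso_index R A = 1" using assms(6) by (simp only: iso_index_def) simp
    moreover have lt: "card R < card (affine_maps R R)"
      by (rule card_less_affine_maps_self[OF finR abR ab(3)])
    moreover have R2: "card R \<ge> 2" using card_mono[OF finR assms(2)] assms(3) by simp
    moreover have "1 \<le> ln (real (card (affine_maps R R))) / ln (real (card R))"
      using lt R2 by (simp add: le_divide_eq)
    ultimately show ?thesis using finR by (intro exI[of _ R]) auto
  qed
  then obtain B where B: "finite B" "card B \<ge> 2" "card B < card (affine_maps R B)"
    "iso_index R A \<le> ln (real (card (affine_maps R B))) / ln (real (card B))" by blast
  show ?thesis
    using sim_max_bigomega[OF B(1,2) finP assms(2) ab B(3)] powr_bigomega_mono[OF B(4)]
    by (rule landau_omega.big_trans)
qed

end
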